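(* Let $X$ be a completely regular Hausdorff space with $|X|>1$. For any vertices $f,g$ of the zero-set intersection graph $\Gamma(C(X))$, the set $\{f,g\}$ dominates $\Gamma(C(X))$ if and only if $Z(f)\cup Z(g)=X$.
   Context: $C(X)$ is the ring of all continuous functions $X\to\mathbb{R}$ with pointwise operations. For $f\in C(X)$, $Z(f)=\{x\in X: f(x)=0\}$. $\Gamma(C(X))$ is the simple graph whose vertex set is the set of non-units of $C(X)$ (equivalently, the $f$ with $Z(f)\neq\emptyset$), two distinct vertices $f,g$ being adjacent iff $Z(f)\cap Z(g)\neq\emptyset$. A set $A$ of vertices dominates the graph if every vertex outside $A$ is adjacent to some vertex of $A$. *)

theory Defs
  imports "HOL-Analysis.Analysis" "HOL-Algebra.Ring"
begin

(* The ring C(X).  Elements are normalised by extensionality, so that two elements of the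
   carrier are equal exactly when they agree on topspace X. *)
definition cont_funs :: "'a topology \<Rightarrow> ('a \<Rightarrow> real) set" where
  "cont_funs X = {f. continuous_map X euclideanreal f \<and> f \<in> extensional (topspace X)}"

definition C_ring :: "'a topology \<Rightarrow> ('a \<Rightarrow> real) ring" where
  "C_ring X =
     \<lparr>carrier = cont_funs X,
      mult = (\<lambda>f g. \<lambda>x\<in>topspace X. f x * g x),
      one = (\<lambda>x\<in>topspace X. 1),
      zero = (\<lambda>x\<in>topspace X. 0),
      add = (\<lambda>f g. \<lambda>x\<in>topspace X. f x + g x)\<rparr>"

definition zero_set :: "'a topology \<Rightarrow> ('a \<Rightarrow> real) \<Rightarrow> 'a set" where
  "zero_set X f = {x \<in> topspace X. f x = 0}"

record 'v sgraph =
  verts :: "'v set"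
  adj :: "'v \<Rightarrow> 'v \<Rightarrow> bool"

definition simple_graph :: "'v sgraph \<Rightarrow> bool" where
  "simple_graph G \<longleftrightarrow>
     (\<forall>u v. adj G u v \<longrightarrow> u \<in> verts G \<and> v \<in> verts G \<and> u \<noteq> v \<and> adj G v u)"

definition dominates :: "'v sgraph \<Rightarrow> 'v set \<Rightarrow> bool" where
  "dominates G A \<longleftrightarrow> A \<subseteq> verts G \<and> (\<forall>v \<in> verts G - A. \<exists>a\<in>A. adj G v a)"

definition zero_set_graph :: "'a topology \<Rightarrow> ('a \<Rightarrow> real) sgraph" where
  "zero_set_graph X =
     \<lparr>verts = carrier (C_ring X) - Units (C_ring X),
      adj = (\<lambda>f g. f \<in> carrier (C_ring X) - Units (C_ring X) \<and>
                   g \<in> carrier (C_ring X) - Units (C_ring X) \<and>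
                   f \<noteq> g \<and> zero_set X f \<inter> zero_set X g \<noteq> {})\<rparr>"

lemma restrict_in_cont_funs:
  "continuous_map X euclideanreal f \<Longrightarrow> restrict f (topspace X) \<in> cont_funs X"
  unfolding cont_funs_def by (auto intro: continuous_map_eq)

lemma cont_funsD:
  assumes "f \<in> cont_funs X"
  shows "continuous_map X euclideanreal f" and "x \<notin> topspace X \<Longrightarrow> f x = undefined"
  using assms by (auto simp: cont_funs_def extensional_def)

lemma C_ring_closed:
  assumes "f \<in> cont_funs X" and "g \<in> cont_funs X"
  shows "(\<lambda>x\<in>topspace X. f x * g x) \<in> cont_funs X"
    and "(\<lambda>x\<in>topspace X. f x + g x) \<in> cont_funs X"
    and "(\<lambda>x\<in>topspace X. - f x) \<in> cont_funs X"
  by (rule restrict_in_cont_funs, simp add: cont_funsD assms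
      continuous_map_real_mult continuous_map_add)+

lemma cring_C_ring: "cring (C_ring X)"
proof (rule cringI)
  show "abelian_group (C_ring X)"
  proof (rule abelian_groupI)
    fix f assume f: "f \<in> carrier (C_ring X)"
    have "(\<lambda>x\<in>topspace X. - f x) \<in> carrier (C_ring X)"
      using f by (simp add: C_ring_def C_ring_closed)
    moreover have "(\<lambda>x\<in>topspace X. - f x) \<oplus>\<^bsub>C_ring X\<^esub> f = \<zero>\<^bsub>C_ring X\<^esub>"
      by (simp add: C_ring_def restrict_def fun_eq_iff)
    ultimately show "\<exists>g\<in>carrier (C_ring X). g \<oplus>\<^bsub>C_ring X\<^esub> f = \<zero>\<^bsub>C_ring X\<^esub>" by blast
  next
    show "\<zero>\<^bsub>C_ring X\<^esub> \<in> carrier (C_ring X)"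
      using restrict_in_cont_funs[of X "\<lambda>x. 0"] by (simp add: C_ring_def)
  next
    fix f g assume "f \<in> carrier (C_ring X)" "g \<in> carrier (C_ring X)"
    then show "f \<oplus>\<^bsub>C_ring X\<^esub> g \<in> carrier (C_ring X)"
      by (simp add: C_ring_def C_ring_closed)
  qed (simp_all add: C_ring_def restrict_def fun_eq_iff cont_funsD add_ac)
  show "comm_monoid (C_ring X)"
  proof (rule comm_monoidI)
    show "\<one>\<^bsub>C_ring X\<^esub> \<in> carrier (C_ring X)"
      using restrict_in_cont_funs[of X "\<lambda>x. 1"] by (simp add: C_ring_def)
  next
    fix f g assume "f \<in> carrier (C_ring X)" "g \<in> carrier (C_ring X)"
    then show "f \<otimes>\<^bsub>C_ring X\<^esub> g \<in> carrier (C_ring X)"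
      by (simp add: C_ring_def C_ring_closed)
  qed (simp_all add: C_ring_def restrict_def fun_eq_iff cont_funsD mult_ac)
qed (simp add: C_ring_def restrict_def fun_eq_iff distrib_right)

lemma Units_C_ring: "Units (C_ring X) = {f \<in> cont_funs X. zero_set X f = {}}"
proof (intro equalityI subsetI)
  fix f assume "f \<in> Units (C_ring X)"
  then obtain g where f: "f \<in> cont_funs X"
    and g: "(\<lambda>x\<in>topspace X. g x * f x) = (\<lambda>x\<in>topspace X. 1)"
    by (auto simp: Units_def C_ring_def)
  have "g x * f x = 1" if "x \<in> topspace X" for x
    using fun_cong[OF g, of x] that by simp
  then show "f \<in> {f \<in> cont_funs X. zero_set X f = {}}"
    using f by (force simp: zero_set_def)
next
  fix f assume f: "f \<in> {f \<in> cont_funs X. zero_set X f = {}}"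
  then have nz: "f x \<noteq> 0" if "x \<in> topspace X" for x
    using that by (auto simp: zero_set_def)
  let ?g = "\<lambda>x\<in>topspace X. inverse (f x)"
  have "?g \<in> cont_funs X"
    using f nz by (intro restrict_in_cont_funs continuous_map_real_inverse) (auto simp: cont_funsD)
  moreover have "(\<lambda>x\<in>topspace X. ?g x * f x) = (\<lambda>x\<in>topspace X. 1)"
    "(\<lambda>x\<in>topspace X. f x * ?g x) = (\<lambda>x\<in>topspace X. 1)"
    using nz by (simp_all add: restrict_def fun_eq_iff)
  ultimately show "f \<in> Units (C_ring X)"
    using f unfolding Units_def C_ring_def by (auto intro!: bexI[of _ ?g])
qed

lemma verts_zero_set_graph:
  "verts (zero_set_graph X) = {f \<in> cont_funs X. zero_set X f \<noteq> {}}"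
  by (auto simp: zero_set_graph_def Units_C_ring) (auto simp: C_ring_def)

lemma simple_graph_zero_set_graph: "simple_graph (zero_set_graph X)"
  by (auto simp: simple_graph_def zero_set_graph_def)

end

theory Submission
  imports Defs
begin

text \<open>A vertex outside \<open>{f, g}\<close> has a neighbour in that set exactly when its zero
  set meets the union C of the zero sets of \<open>f\<close> and \<open>g\<close>. If C is the whole
  space this is automatic, since every vertex has a zero. If C misses a point, then, C being closed
  (\<open>closedin_zero_set\<close>), complete regularity yields a vertex that vanishes at this
  point but nowhere on C (\<open>ex_vertex_separating\<close>), so \<open>{f, g}\<close> fails to
  dominate it.\<close>

lemma closedin_zero_set:
  assumes "continuous_map X euclideanreal f"
  shows "closedin X (zero_set X f)"
  using closedin_continuous_map_preimage[OF assms, of "{0}"] by (simp add: zero_set_def)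

lemma adj_zero_set_graph:
  "adj (zero_set_graph X) f g \<longleftrightarrow>
     f \<in> verts (zero_set_graph X) \<and> g \<in> verts (zero_set_graph X) \<and>
     f \<noteq> g \<and> zero_set X f \<inter> zero_set X g \<noteq> {}"
  by (simp add: zero_set_graph_def)

text \<open>Complete regularity gives a continuous function that is 0 at \<open>x\<close> and 1 on
  \<open>C\<close>: the zero at \<open>x\<close> makes it a non-unit, hence a vertex, and the value
  1 keeps its zeros off \<open>C\<close>.\<close>

lemma ex_vertex_separating:
  assumes "completely_regular_space X" and "closedin X C" and "x \<in> topspace X - C"
  obtains h where "h \<in> verts (zero_set_graph X)" and "zero_set X h \<inter> C = {}"
proof -
  obtain h where h: "continuous_map X euclideanreal h" "h x = 0" "h ` C \<subseteq> {1}"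
    using assms unfolding completely_regular_space_def continuous_map_in_subtopology by meson
  \<comment> \<open>Ring elements are extensional, so \<open>h\<close> is cut down to
    \<open>topspace X\<close>; its zero set does not change.\<close>
  let ?h = "restrict h (topspace X)"
  have "?h \<in> verts (zero_set_graph X)"
    using h assms(3) by (auto simp: verts_zero_set_graph restrict_in_cont_funs zero_set_def)
  moreover have "zero_set X ?h \<inter> C = {}"
    using h(3) by (auto simp: zero_set_def)
  ultimately show thesis ..
qed

theorem theorem4p2:
  fixes X :: "'a topology" and f g :: "'a \<Rightarrow> real"
  assumes "completely_regular_space X"
    and "Hausdorff_space X"
    and "\<exists>x\<in>topspace X. \<exists>y\<in>topspace X. x \<noteq> y"
    and "f \<in> verts (zero_set_graph X)"
    and "g \<in> verts (zero_set_graph X)"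
  shows "dominates (zero_set_graph X) {f, g} \<longleftrightarrow> zero_set X f \<union> zero_set X g = topspace X"
proof
  let ?C = "zero_set X f \<union> zero_set X g"
  assume dom: "dominates (zero_set_graph X) {f, g}"
  show "?C = topspace X"
  proof (rule ccontr)
    assume "?C \<noteq> topspace X"
    then obtain x where "x \<in> topspace X - ?C"
      by (auto simp: zero_set_def)
    moreover have "closedin X ?C"
      using assms(4,5)
      by (intro closedin_Un closedin_zero_set) (auto simp: verts_zero_set_graph cont_funsD)
    ultimately obtain h where h: "h \<in> verts (zero_set_graph X)" "zero_set X h \<inter> ?C = {}"
      using ex_vertex_separating[OF assms(1)] by blast
    \<comment> \<open>Domination only constrains vertices outside the set. As \<open>h\<close> has a
      zero but none in \<open>?C\<close>, it is neither \<open>f\<close> nor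
      \<open>g\<close>.\<close>
    then have "h \<notin> {f, g}"
      by (auto simp: verts_zero_set_graph)
    then show False
      using dom h by (auto simp: dominates_def adj_zero_set_graph)
  qed
next
  assume cover: "zero_set X f \<union> zero_set X g = topspace X"
  have "\<exists>a\<in>{f, g}. adj (zero_set_graph X) h a"
    if h: "h \<in> verts (zero_set_graph X) - {f, g}" for h
  proof -
    obtain x where "x \<in> zero_set X h"
      using h by (auto simp: verts_zero_set_graph)
    \<comment> \<open>Whichever of \<open>f\<close> and \<open>g\<close> vanishes at
      \<open>x\<close> shares this zero with \<open>h\<close> and is the required neighbour.\<close>
    moreover from this have "x \<in> zero_set X f \<union> zero_set X g"
      unfolding cover by (simp add: zero_set_def)
    ultimately show ?thesis
      using h assms(4,5) by (auto simp: adj_zero_set_graph)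
  qed
  then show "dominates (zero_set_graph X) {f, g}"
    using assms(4,5) by (auto simp: dominates_def)
qed

end
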